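(* Let $k$ be a field, $R=k[a,b,c,d]$, let $a_1,\dots,a_6\ge 0$ be integers, not all zero, and let \[ I=(a,b)^{a_1}\cap(a,c)^{a_2}\cap(a,d)^{a_3}\cap(b,c)^{a_4}\cap(b,d)^{a_5}\cap(c,d)^{a_6}\subset R . \] Consider the following systems of inequalities: (A): $a_1+a_2\ge a_4$, $a_1+a_3\ge a_5$, $a_2+a_3\ge a_6$; (B): $a_1+a_4\ge a_2$, $a_1+a_5\ge a_3$, $a_4+a_5\ge a_6$; (C): $a_2+a_4\ge a_1$, $a_2+a_6\ge a_3$, $a_4+a_6\ge a_5$; (D): $a_3+a_5\ge a_1$, $a_3+a_6\ge a_2$, $a_5+a_6\ge a_4$. For $1\le i\le 6$ let $a_i'=\max\{0,a_i-1\}$. Then: (i) (A) holds if and only if $I$ is a basic double link of $(a,b)^{a_1'}\cap(a,c)^{a_2'}\cap(a,d)^{a_3'}\cap(b,c)^{a_4}\cap(b,d)^{a_5}\cap(c,d)^{a_6}$ using $F=b^{a_1}c^{a_2}d^{a_3}$ and $G=a$. (ii) (B) holds if and only if $I$ is a basic double link of $(a,b)^{a_1'}\cap(a,c)^{a_2}\cap(a,d)^{a_3}\cap(b,c)^{a_4'}\cap(b,d)^{a_5'}\cap(c,d)^{a_6}$ using $F=a^{a_1}c^{a_4}d^{a_5}$ and $G=b$. (iii) (C) holds if and only if $I$ is a basic double link of $(a,b)^{a_1}\cap(a,c)^{a_2'}\cap(a,d)^{a_3}\cap(b,c)^{a_4'}\cap(b,d)^{a_5}\cap(c,d)^{a_6'}$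 using $F=a^{a_2}b^{a_4}d^{a_6}$ and $G=c$. (iv) (D) holds if and only if $I$ is a basic double link of $(a,b)^{a_1}\cap(a,c)^{a_2}\cap(a,d)^{a_3'}\cap(b,c)^{a_4}\cap(b,d)^{a_5'}\cap(c,d)^{a_6'}$ using $F=a^{a_3}b^{a_5}c^{a_6}$ and $G=d$.
   Context: Basic double link: let $I'\subset R$ be the saturated ideal of an unmixed curve in $\mathbb P^3$ (the unit ideal $I'=R$, the ideal of the "trivial curve", is allowed). An ideal $I$ is a basic double link of $I'$ using homogeneous polynomials $F$ and $G$ if $F\in I'$, $(F,G)$ is a regular sequence in $R$, and $I=G\cdot I'+(F)$. A zeroth power of an ideal is $R$. *)

theory Defs
  imports
    "HOL-Library.Poly_Mapping"
    "HOL-Library.Extended_Nat"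
    "HOL-Algebra.Ideal_Product"
    "HOL-Algebra.Algebraic_Closure_Type"
begin

section \<open>The polynomial ring \<open>k[a,b,c,d]\<close>\<close>

datatype coord = A | B | C | D

text \<open>
  A monomial is its finitely supported exponent vector, and a polynomial is a finitely supported
  function from monomials to coefficients (with the convolution product of \<open>Poly_Mapping\<close>).
\<close>

type_synonym 'k pol = "(coord \<Rightarrow>\<^sub>0 nat) \<Rightarrow>\<^sub>0 'k"

abbreviation S :: "'k::field pol ring" where
  "S \<equiv> ring_of_type_algebra"

definition Var :: "coord \<Rightarrow> 'k::field pol" where
  "Var v = Poly_Mapping.single (Poly_Mapping.single v 1) 1"

definition monom_degree :: "(coord \<Rightarrow>\<^sub>0 nat) \<Rightarrow> nat" where
  "monom_degree m = (\<Sum>v\<in>UNIV. Poly_Mapping.lookup m v)"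

text \<open>The zero polynomial counts as homogeneous (of every degree).\<close>

definition homogeneous :: "'k::field pol \<Rightarrow> bool" where
  "homogeneous f \<longleftrightarrow> (\<exists>d. \<forall>m\<in>Poly_Mapping.keys f. monom_degree m = d)"

definition homogeneous_ideal :: "'k::field pol set \<Rightarrow> bool" where
  "homogeneous_ideal J \<longleftrightarrow> ideal J S \<and> J = Idl\<^bsub>S\<^esub> {f \<in> J. homogeneous f}"

text \<open>
  Powers are taken in the multiplicative monoid of ideals, whose unit is the whole ring;
  hence the zeroth power of an ideal is the unit ideal.
\<close>

abbreviation ideal_power :: "'k::field pol set \<Rightarrow> nat \<Rightarrow> 'k pol set" where
  "ideal_power J n \<equiv> J [^]\<^bsub>ideals_set S\<^esub> n"


section \<open>Unmixed curves in projective three-space\<close>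

definition irrelevant_ideal :: "'k::field pol set" where
  "irrelevant_ideal = Idl\<^bsub>S\<^esub> (range Var)"

definition saturation :: "'k::field pol set \<Rightarrow> 'k pol set" where
  "saturation J = {f. \<exists>n. \<forall>g\<in>ideal_power irrelevant_ideal n. g * f \<in> J}"

text \<open>The points of the scheme \<open>Proj k[a,b,c,d]\<close>.\<close>

definition proj_points :: "'k::field pol set set" where
  "proj_points = {P. primeideal P S \<and> homogeneous_ideal P \<and> \<not> irrelevant_ideal \<subseteq> P}"

text \<open>
  The Krull dimension of the closed subset \<open>V(J)\<close> of \<open>Proj k[a,b,c,d]\<close>: the supremum of the lengths
  of chains of points containing \<open>J\<close> (a chain of irreducible closed subsets is the same as a chain
  of their generic points).  The empty subset gets the value 0 here, not \<open>-\<infinity>\<close>; this is harmless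
  below, where the value is only ever compared with 1.
\<close>

definition proj_dim :: "'k::field pol set \<Rightarrow> enat" where
  "proj_dim J = Sup {enat n | n. \<exists>Q :: nat \<Rightarrow> 'k pol set.
     (\<forall>i\<le>n. Q i \<in> proj_points \<and> J \<subseteq> Q i) \<and> (\<forall>i<n. Q i \<subset> Q (Suc i))}"

text \<open>The associated primes of the module \<open>k[a,b,c,d]/J\<close>: prime annihilators of elements.\<close>

definition associated_primes :: "'k::field pol set \<Rightarrow> 'k pol set set" where
  "associated_primes J = {P. primeideal P S \<and> (\<exists>f. P = {g. g * f \<in> J})}"

text \<open>
  A curve is a closed subscheme of dimension 1, and it is unmixed when all its associated
  points (in particular the embedded ones) have dimension 1.
\<close>

definition unmixed_curve_ideal :: "'k::field pol set \<Rightarrow> bool" where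
  "unmixed_curve_ideal J \<longleftrightarrow>
     homogeneous_ideal J \<and> saturation J = J \<and> proj_dim J = 1 \<and>
     (\<forall>P\<in>associated_primes J. proj_dim P = 1)"


section \<open>Basic double links\<close>

definition regular_sequence2 :: "'k::field pol \<Rightarrow> 'k pol \<Rightarrow> bool" where
  "regular_sequence2 F G \<longleftrightarrow>
     (\<forall>h. F * h = 0 \<longrightarrow> h = 0) \<and>
     (\<forall>h. G * h \<in> PIdl\<^bsub>S\<^esub> F \<longrightarrow> h \<in> PIdl\<^bsub>S\<^esub> F) \<and>
     Idl\<^bsub>S\<^esub> {F, G} \<noteq> carrier S"

definition basic_double_link ::
  "'k::field pol set \<Rightarrow> 'k pol set \<Rightarrow> 'k pol \<Rightarrow> 'k pol \<Rightarrow> bool" where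
  "basic_double_link J J' F G \<longleftrightarrow>
     (J' = carrier S \<or> unmixed_curve_ideal J') \<and>
     homogeneous F \<and> homogeneous G \<and> F \<in> J' \<and> regular_sequence2 F G \<and>
     J = ((\<lambda>h. G * h) ` J') <+>\<^bsub>S\<^esub> (PIdl\<^bsub>S\<^esub> F)"


section \<open>The ideals under consideration\<close>

definition line_ideal :: "coord \<Rightarrow> coord \<Rightarrow> 'k::field pol set" where
  "line_ideal x y = Idl\<^bsub>S\<^esub> {Var x, Var y}"

definition tetrahedral_ideal ::
  "nat \<Rightarrow> nat \<Rightarrow> nat \<Rightarrow> nat \<Rightarrow> nat \<Rightarrow> nat \<Rightarrow> 'k::field pol set" where
  "tetrahedral_ideal a1 a2 a3 a4 a5 a6 =
     ideal_power (line_ideal A B) a1 \<inter>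
     ideal_power (line_ideal A C) a2 \<inter>
     ideal_power (line_ideal A D) a3 \<inter>
     ideal_power (line_ideal B C) a4 \<inter>
     ideal_power (line_ideal B D) a5 \<inter>
     ideal_power (line_ideal C D) a6"

end

theory Submission
  imports Defs
begin

text \<open>
  All ideals involved are monomial, so membership is a condition on exponent vectors: \<open>m\<close> lies in
  the tetrahedral ideal iff \<open>m x + m y\<close> is at least the weight of the edge \<open>{x, y}\<close>, for every
  edge.  For a vertex \<open>v\<close>, a monomial of \<open>I\<close> divisible by \<open>v\<close> is \<open>v\<close> times a monomial of \<open>I'\<close>, and
  one not divisible by \<open>v\<close> is a multiple of \<open>F\<close>; the triangle inequalities say precisely that
  \<open>F \<in> I'\<close>.  That \<open>I'\<close> is the ideal of an unmixed curve (or the unit ideal) follows because powers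
  of the line ideals \<open>(x, y)\<close> are primary and because, by dehomogenising to the principal ideal
  domain \<open>k[t]\<close>, a prime containing \<open>(x, y)\<close> never starts a chain of three points of \<open>Proj\<close>.
\<close>

text \<open>\<open>Poly_Mapping\<close> provides the integral domain instance of the polynomial ring only over
  linearly ordered exponents.\<close>

instantiation coord :: linorder
begin

fun coord_index :: "coord \<Rightarrow> nat" where
  "coord_index A = 0" | "coord_index B = 1" | "coord_index C = 2" | "coord_index D = 3"

definition less_eq_coord :: "coord \<Rightarrow> coord \<Rightarrow> bool" where
  "x \<le> y \<longleftrightarrow> coord_index x \<le> coord_index y"

definition less_coord :: "coord \<Rightarrow> coord \<Rightarrow> bool" where
  "x < y \<longleftrightarrow> coord_index x < coord_index y"

instance
proof
  fix x y :: coord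
  show "x \<le> y \<Longrightarrow> y \<le> x \<Longrightarrow> x = y"
    by (cases x; cases y) (simp_all add: less_eq_coord_def)
qed (auto simp: less_eq_coord_def less_coord_def)

end

lemma UNIV_coord: "UNIV = {A, B, C, D}"
  using coord.exhaust by auto

instance coord :: finite
  by standard (simp add: UNIV_coord)

type_synonym mon = "coord \<Rightarrow>\<^sub>0 nat"

abbreviation expo :: "mon \<Rightarrow> coord \<Rightarrow> nat" where
  "expo \<equiv> Poly_Mapping.lookup"

section \<open>The polynomial ring as a HOL-Algebra structure\<close>

lemma S_simps [simp]:
  "carrier (S :: 'k::field pol ring) = UNIV"
  "x \<otimes>\<^bsub>(S :: 'k pol ring)\<^esub> y = x * y"
  "x \<oplus>\<^bsub>(S :: 'k pol ring)\<^esub> y = x + y"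
  "\<one>\<^bsub>(S :: 'k pol ring)\<^esub> = 1"
  "\<zero>\<^bsub>(S :: 'k pol ring)\<^esub> = 0"
  by (simp_all add: ring_of_type_algebra_def)

interpretation S: cring "S :: 'k::field pol ring"
  by (rule cring_from_type_algebra)

text \<open>Multiplication by \<open>-1\<close> supplies negatives, so the additive subgroup
  condition reduces to \<open>0\<close> and sums.\<close>

lemma ideal_S_iff:
  fixes J :: "'k::field pol set"
  shows "ideal J S \<longleftrightarrow> 0 \<in> J \<and> (\<forall>f\<in>J. \<forall>g\<in>J. f + g \<in> J) \<and> (\<forall>f\<in>J. \<forall>g. g * f \<in> J)"
proof
  assume "ideal J S"
  then interpret ideal J S .
  show "0 \<in> J \<and> (\<forall>f\<in>J. \<forall>g\<in>J. f + g \<in> J) \<and> (\<forall>f\<in>J. \<forall>g. g * f \<in> J)"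
    using zero_closed a_closed I_l_closed by auto
next
  assume J: "0 \<in> J \<and> (\<forall>f\<in>J. \<forall>g\<in>J. f + g \<in> J) \<and> (\<forall>f\<in>J. \<forall>g. g * f \<in> J)"
  have *: "- f \<in> J" if "f \<in> J" for f
    using J that by (metis mult_minus1)
  have "inv\<^bsub>add_monoid S\<^esub> f = - f" for f :: "'k pol"
    using S.minus_equality[of "- f" f] by (simp add: a_inv_def)
  then have "subgroup J (add_monoid S)"
    using J * by (intro subgroup.intro) auto
  then show "ideal J S"
    using J by (intro idealI) (auto simp: S.ring_axioms mult.commute)
qed

lemma ideal_addD: "ideal J S \<Longrightarrow> f \<in> J \<Longrightarrow> g \<in> J \<Longrightarrow> f + g \<in> J"
  and ideal_multD: "ideal J S \<Longrightarrow> f \<in> J \<Longrightarrow> g * f \<in> J"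
  for J :: "'k::field pol set"
  by (simp_all add: ideal_S_iff)

lemma primeideal_S_iff:
  fixes P :: "'k::field pol set"
  shows "primeideal P S \<longleftrightarrow> ideal P S \<and> 1 \<notin> P \<and> (\<forall>f g. f * g \<in> P \<longrightarrow> f \<in> P \<or> g \<in> P)"
proof
  assume "primeideal P S"
  then interpret primeideal P S .
  show "ideal P S \<and> 1 \<notin> P \<and> (\<forall>f g. f * g \<in> P \<longrightarrow> f \<in> P \<or> g \<in> P)"
    using is_ideal I_notcarr I_prime one_imp_carrier by auto
next
  assume "ideal P S \<and> 1 \<notin> P \<and> (\<forall>f g. f * g \<in> P \<longrightarrow> f \<in> P \<or> g \<in> P)"
  then show "primeideal P S"
    by (intro primeidealI) (auto simp: S.is_cring)
qed

lemma genideal_S_subset: "Y \<subseteq> Idl\<^bsub>S\<^esub> Y" for Y :: "'k::field pol set"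
  by (rule S.genideal_self) simp

lemma ideal_genideal_S: "ideal (Idl\<^bsub>S\<^esub> Y) S" for Y :: "'k::field pol set"
  by (rule S.genideal_ideal) simp

lemma PIdl_S: "PIdl\<^bsub>S\<^esub> F = {h * F | h. True}" for F :: "'k::field pol"
  by (simp add: cgenideal_def)

lemma ideal_sum_closed:
  fixes J :: "'k::field pol set"
  assumes "ideal J S" "\<And>i. i \<in> Y \<Longrightarrow> f i \<in> J"
  shows "sum f Y \<in> J"
  using assms(2) by (induction Y rule: infinite_finite_induct)
    (use assms(1) in \<open>auto simp: ideal_S_iff\<close>)

section \<open>Monomial ideals\<close>

text \<open>The \<open>k\<close>-span of the monomials with exponent vector in \<open>U\<close>. It
  is an ideal once \<open>U\<close> is \<open>up_closed\<close>, that is, stable under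
  multiplication by monomials.\<close>

definition mon_ideal :: "mon set \<Rightarrow> 'k::field pol set" where
  "mon_ideal U = {f. Poly_Mapping.keys f \<subseteq> U}"

definition up_closed :: "mon set \<Rightarrow> bool" where
  "up_closed U \<longleftrightarrow> (\<forall>m\<in>U. \<forall>n. n + m \<in> U)"

lemma keys_multD:
  assumes "m \<in> Poly_Mapping.keys (f * g)"
  obtains p q where "p \<in> Poly_Mapping.keys f" "q \<in> Poly_Mapping.keys g" "m = p + q"
  using keys_mult[of f g] assms by blast

lemma keys_addD: "m \<in> Poly_Mapping.keys (f + g) \<Longrightarrow> m \<in> Poly_Mapping.keys f \<or> m \<in> Poly_Mapping.keys g"
  using keys_add[of f g] by blast

lemma poly_sum_singles:
  fixes f :: "'k::field pol"
  shows "f = (\<Sum>m\<in>Poly_Mapping.keys f. Poly_Mapping.single m (Poly_Mapping.lookup f m))"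
  by (rule poly_mapping_eqI) (auto simp: lookup_sum lookup_single when_def in_keys_iff)

lemma ideal_mon_ideal: "up_closed U \<Longrightarrow> ideal (mon_ideal U :: 'k::field pol set) S"
  unfolding ideal_S_iff mon_ideal_def up_closed_def
  by (auto dest!: keys_addD elim!: keys_multD)

text \<open>A polynomial is the sum of its terms and a term is a constant times a monomial, so
  containment in an ideal can be tested on monomials.\<close>

lemma mon_ideal_subset:
  fixes J :: "'k::field pol set"
  assumes "ideal J S" "\<And>m. m \<in> U \<Longrightarrow> Poly_Mapping.single m 1 \<in> J"
  shows "mon_ideal U \<subseteq> J"
proof
  fix f :: "'k pol"
  assume f: "f \<in> mon_ideal U"
  have "Poly_Mapping.single m c \<in> J" if "m \<in> U" for m c
    using assms that mult_single[of 0 c m 1] unfolding ideal_S_iff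
    by (metis add_0 mult.right_neutral)
  with f show "f \<in> J"
    by (subst poly_sum_singles) (intro ideal_sum_closed[OF assms(1)], auto simp: mon_ideal_def)
qed

lemma homogeneous_single: "homogeneous (Poly_Mapping.single m c :: 'k::field pol)"
  by (auto simp: homogeneous_def)

lemma single_in_mon_ideal [simp]:
  "Poly_Mapping.single m (1 :: 'k::field) \<in> mon_ideal U \<longleftrightarrow> m \<in> U"
  by (simp add: mon_ideal_def)

text \<open>Monomials are homogeneous and generate the ideal.\<close>

lemma homogeneous_mon_ideal:
  assumes "up_closed U"
  shows "homogeneous_ideal (mon_ideal U :: 'k::field pol set)"
proof -
  have "mon_ideal U \<subseteq> Idl\<^bsub>S\<^esub> {f \<in> mon_ideal U. homogeneous (f :: 'k pol)}"
    by (rule mon_ideal_subset[OF ideal_genideal_S])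
      (auto intro!: subsetD[OF genideal_S_subset] homogeneous_single)
  moreover have "Idl\<^bsub>S\<^esub> {f \<in> mon_ideal U. homogeneous (f :: 'k pol)} \<subseteq> mon_ideal U"
    by (rule S.genideal_minimal[OF ideal_mon_ideal[OF assms]]) auto
  ultimately show ?thesis
    using ideal_mon_ideal[OF assms] unfolding homogeneous_ideal_def by blast
qed

section \<open>Powers of ideals generated by variables\<close>

text \<open>The grading in which the variables of \<open>V\<close> have weight 1 and the others
  weight 0.\<close>

definition var_degree :: "coord set \<Rightarrow> mon \<Rightarrow> nat" where
  "var_degree V m = (\<Sum>v\<in>V. expo m v)"

lemma var_degree_add [simp]: "var_degree V (m + n) = var_degree V m + var_degree V n"
  by (simp add: var_degree_def lookup_add sum.distrib)

lemma var_degree_zero [simp]: "var_degree V 0 = 0"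
  by (simp add: var_degree_def)

lemma var_degree_single [simp]: "var_degree V (Poly_Mapping.single v n) = (n when v \<in> V)"
  by (simp add: var_degree_def lookup_single when_def)

lemma monom_degree_eq: "monom_degree m = var_degree UNIV m"
  by (simp add: monom_degree_def var_degree_def)

text \<open>Stands for the \<open>n\<close>-th power of the ideal generated by the variables in
  \<open>V\<close>, described by its monomials; \<open>ideal_power_vars\<close> justifies
  this.\<close>

definition var_power :: "coord set \<Rightarrow> nat \<Rightarrow> 'k::field pol set" where
  "var_power V n = mon_ideal {m. n \<le> var_degree V m}"

lemma up_closed_var_degree: "up_closed {m. n \<le> var_degree V m}"
  by (simp add: up_closed_def)

lemma ideal_var_power: "ideal (var_power V n :: 'k::field pol set) S"
  unfolding var_power_def by (rule ideal_mon_ideal[OF up_closed_var_degree])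

lemma var_power_0 [simp]: "var_power V 0 = UNIV"
  by (simp add: var_power_def mon_ideal_def)

lemma Var_in_var_power [simp]: "(Var v :: 'k::field pol) \<in> var_power V (Suc 0) \<longleftrightarrow> v \<in> V"
  by (simp add: var_power_def Var_def when_def)

lemma monomial_remove_var:
  assumes "0 < expo m v"
  obtains n where "m = n + Poly_Mapping.single v 1"
proof
  show "m = (m - Poly_Mapping.single v 1) + Poly_Mapping.single v 1"
    using assms by (intro poly_mapping_eqI) (auto simp: lookup_add lookup_minus lookup_single when_def)
qed

lemma var_degree_posD:
  assumes "0 < var_degree V m"
  obtains v n where "v \<in> V" "m = n + Poly_Mapping.single v 1"
proof -
  have "\<exists>v\<in>V. 0 < expo m v"
  proof (rule ccontr)
    assume "\<not> ?thesis"
    then have "var_degree V m = 0"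
      by (simp add: var_degree_def)
    with assms show False by simp
  qed
  then obtain v where "v \<in> V" "0 < expo m v"
    by blast
  then show ?thesis
    using that by (meson monomial_remove_var)
qed

lemma genideal_vars: "Idl\<^bsub>S\<^esub> (Var ` V :: 'k::field pol set) = var_power V 1"
proof
  show "Idl\<^bsub>S\<^esub> (Var ` V :: 'k pol set) \<subseteq> var_power V 1"
    by (rule S.genideal_minimal[OF ideal_var_power]) auto
  have I: "ideal (Idl\<^bsub>S\<^esub> (Var ` V :: 'k pol set)) S"
    by (rule ideal_genideal_S)
  show "var_power V 1 \<subseteq> Idl\<^bsub>S\<^esub> (Var ` V :: 'k pol set)"
    unfolding var_power_def
  proof (rule mon_ideal_subset[OF I])
    fix m assume "m \<in> {m. 1 \<le> var_degree V m}"
    then have "0 < var_degree V m"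
      by simp
    then obtain v n where v: "v \<in> V" "m = n + Poly_Mapping.single v 1"
      by (rule var_degree_posD)
    have "Poly_Mapping.single m (1::'k) = Poly_Mapping.single n 1 * Var v"
      by (simp only: v Var_def mult_single S_simps mult_1)
    moreover have "(Var v :: 'k pol) \<in> Idl\<^bsub>S\<^esub> (Var ` V)"
      using genideal_S_subset v by blast
    ultimately show "Poly_Mapping.single m (1::'k) \<in> Idl\<^bsub>S\<^esub> (Var ` V)"
      using ideal_multD[OF I] by metis
  qed
qed

text \<open>Induction on \<open>n\<close>: \<open>V\<close>-degrees add in products, and a monomial
  of \<open>V\<close>-degree at least \<open>Suc n\<close> is a variable of \<open>V\<close> times a
  monomial of \<open>V\<close>-degree at least \<open>n\<close>.\<close>

lemma ideal_power_vars:
  "ideal_power (var_power V 1 :: 'k::field pol set) n = var_power V n"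
proof (induction n)
  case 0
  show ?case by (simp add: ideals_set_def)
next
  case (Suc n)
  let ?P = "ideal_prod S (var_power V n) (var_power V 1) :: 'k pol set"
  have I: "ideal ?P S"
    by (intro S.ideal_prod_is_ideal ideal_var_power)
  have "?P = var_power V (Suc n)"
  proof
    show "?P \<subseteq> var_power V (Suc n)"
    proof
      fix f assume "f \<in> ?P"
      then show "f \<in> var_power V (Suc n)"
      proof (induction f)
        case (prod i j)
        have "Suc n \<le> var_degree V m" if "m \<in> Poly_Mapping.keys (i * j)" for m
        proof -
          from that obtain p q where "p \<in> Poly_Mapping.keys i" "q \<in> Poly_Mapping.keys j" "m = p + q"
            by (rule keys_multD)
          moreover have "n \<le> var_degree V p" "1 \<le> var_degree V q"
            using prod calculation unfolding var_power_def mon_ideal_def by blast+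
          ultimately show ?thesis by simp
        qed
        then show ?case
          by (auto simp: var_power_def mon_ideal_def)
      next
        case (sum f g)
        then show ?case
          by (simp add: ideal_addD[OF ideal_var_power])
      qed
    qed
    show "var_power V (Suc n) \<subseteq> ?P"
      unfolding var_power_def[of V "Suc n"]
    proof (rule mon_ideal_subset[OF I])
      fix m assume "m \<in> {m. Suc n \<le> var_degree V m}"
      then have m: "Suc n \<le> var_degree V m"
        by simp
      then have "0 < var_degree V m"
        by simp
      then obtain v p where v: "v \<in> V" "m = p + Poly_Mapping.single v 1"
        by (rule var_degree_posD)
      have "n \<le> var_degree V p"
        using m v by simp
      then have "Poly_Mapping.single p (1::'k) \<in> var_power V n"
        by (simp add: var_power_def)
      moreover have "(Var v :: 'k pol) \<in> var_power V 1"
        using v(1) by simp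
      ultimately have "Poly_Mapping.single p (1::'k) \<otimes>\<^bsub>S\<^esub> Var v \<in> ?P"
        by (rule ideal_prod.prod)
      moreover have "Poly_Mapping.single m (1::'k) = Poly_Mapping.single p 1 * Var v"
        unfolding v(2) by (simp add: Var_def mult_single)
      ultimately show "Poly_Mapping.single m (1::'k) \<in> ?P"
        by simp
    qed
  qed
  moreover have "ideal_power (var_power V 1 :: 'k pol set) (Suc n) = 
     ideal_prod S (ideal_power (var_power V 1) n) (var_power V 1)"
    by (simp add: ideals_set_def nat_pow_def)
  ultimately show ?case
    using Suc by metis
qed

section \<open>The valuation given by a set of variables\<close>

lemma lookup_restriction:
  fixes f :: "'k::field pol"
  shows "Poly_Mapping.lookup (\<Sum>m\<in>Poly_Mapping.keys f \<inter> U. Poly_Mapping.single m (Poly_Mapping.lookup f m)) n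
    = (Poly_Mapping.lookup f n when n \<in> U)"
  by (auto simp: lookup_sum lookup_single when_def in_keys_iff)

lemma poly_split:
  fixes f :: "'k::field pol"
  obtains g h where "f = g + h" "Poly_Mapping.keys g = Poly_Mapping.keys f \<inter> U"
    "Poly_Mapping.keys h = Poly_Mapping.keys f - U"
proof
  let ?r = "\<lambda>U. (\<Sum>m\<in>Poly_Mapping.keys f \<inter> U. Poly_Mapping.single m (Poly_Mapping.lookup f m))"
  show "f = ?r U + ?r (- U)"
    by (rule poly_mapping_eqI) (auto simp: lookup_add lookup_restriction when_def)
  show "Poly_Mapping.keys (?r U) = Poly_Mapping.keys f \<inter> U"
    "Poly_Mapping.keys (?r (- U)) = Poly_Mapping.keys f - U"
    by (auto simp: in_keys_iff lookup_restriction when_def split: if_splits)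
qed

text \<open>The lowest \<open>V\<close>-degree parts of \<open>f\<close> and \<open>g\<close> have a nonzero product, which is not
  cancelled by the other terms of \<open>g * f\<close>.\<close>

lemma var_power_primary:
  fixes f g :: "'k::field pol"
  assumes "g * f \<in> var_power V a" "g \<notin> var_power V 1"
  shows "f \<in> var_power V a"
proof (rule ccontr)
  assume "f \<notin> var_power V a"
  then obtain m0 where m0: "m0 \<in> Poly_Mapping.keys f" "var_degree V m0 < a"
    by (force simp: var_power_def mon_ideal_def)
  \<comment> \<open>The order of \<open>f\<close> in the \<open>V\<close>-grading; \<open>m0\<close>
    shows that it is below \<open>a\<close>.\<close>
  define d where "d = (LEAST d. \<exists>m\<in>Poly_Mapping.keys f. var_degree V m = d)"
  have d_ex: "\<exists>m\<in>Poly_Mapping.keys f. var_degree V m = d"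
    unfolding d_def by (rule LeastI_ex) (use m0 in blast)
  have d_le: "d \<le> var_degree V m" if "m \<in> Poly_Mapping.keys f" for m
    unfolding d_def by (rule Least_le) (use that in blast)
  have da: "d < a"
    using d_le[OF m0(1)] m0(2) by simp
  obtain f0 f1 where f: "f = f0 + f1" "Poly_Mapping.keys f0 = Poly_Mapping.keys f \<inter> {m. var_degree V m = d}"
    "Poly_Mapping.keys f1 = Poly_Mapping.keys f - {m. var_degree V m = d}"
    by (rule poly_split)
  obtain g0 g1 where g: "g = g0 + g1" "Poly_Mapping.keys g0 = Poly_Mapping.keys g \<inter> {m. var_degree V m = 0}"
    "Poly_Mapping.keys g1 = Poly_Mapping.keys g - {m. var_degree V m = 0}"
    by (rule poly_split)
  have "f0 \<noteq> 0"
    using d_ex f(2) by auto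
  \<comment> \<open>A polynomial outside the ideal generated by \<open>V\<close> has a term free of
    the variables in \<open>V\<close>.\<close>
  moreover have "g0 \<noteq> 0"
    using assms(2) g(2) by (force simp: var_power_def mon_ideal_def)
  ultimately have "g0 * f0 \<noteq> 0"
    by simp
  then obtain m where m: "m \<in> Poly_Mapping.keys (g0 * f0)"
    by (metis ex_in_conv keys_eq_empty)
  then have md: "var_degree V m = d"
    using f(2) g(2) by (auto elim!: keys_multD)
  have low1: "d < var_degree V p" if "p \<in> Poly_Mapping.keys f1" for p
    using that d_le[of p] by (auto simp: f(3))
  have low0: "var_degree V p = d" if "p \<in> Poly_Mapping.keys f0" for p
    using that by (auto simp: f(2))
  \<comment> \<open>All terms of these products have \<open>V\<close>-degree above \<open>d\<close>,
    since \<open>f1\<close> has only terms of degree above \<open>d\<close> and \<open>g1\<close>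
    only terms of positive degree.\<close>
  have rest: "m \<notin> Poly_Mapping.keys (g0 * f1)" "m \<notin> Poly_Mapping.keys (g1 * f0)" "m \<notin> Poly_Mapping.keys (g1 * f1)"
    by (auto elim!: keys_multD dest!: low1 low0 simp: g(2,3) md[symmetric])
  have "g * f = g0 * f0 + (g0 * f1 + g1 * f0 + g1 * f1)"
    by (simp add: f(1) g(1) algebra_simps)
  then have "m \<in> Poly_Mapping.keys (g * f)"
    using m rest by (simp add: in_keys_iff lookup_add)
  with assms(1) md da show False
    by (auto simp: var_power_def mon_ideal_def)
qed

text \<open>The case \<open>a = 1\<close> of \<open>var_power_primary\<close> is primality.\<close>

lemma primeideal_vars: "primeideal (var_power V 1 :: 'k::field pol set) S"
proof -
  have "(1 :: 'k pol) \<notin> var_power V 1"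
    by (simp add: var_power_def mon_ideal_def)
  then show ?thesis
    using var_power_primary[of _ _ V 1] ideal_var_power[of V 1] unfolding primeideal_S_iff by blast
qed

section \<open>Homogeneous primes containing a line\<close>

text \<open>Naming the degree makes sums controllable. The zero polynomial has every degree, so
  cancellation does no harm.\<close>

definition homog_deg :: "nat \<Rightarrow> 'k::field pol \<Rightarrow> bool" where
  "homog_deg d f \<longleftrightarrow> (\<forall>m\<in>Poly_Mapping.keys f. monom_degree m = d)"

lemma homogeneous_iff: "homogeneous f \<longleftrightarrow> (\<exists>d. homog_deg d f)"
  by (simp add: homogeneous_def homog_deg_def)

lemma homog_deg_add: "homog_deg d f \<Longrightarrow> homog_deg d g \<Longrightarrow> homog_deg d (f + g)"
  by (auto simp: homog_deg_def dest!: keys_addD)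

lemma homog_deg_diff: "homog_deg d f \<Longrightarrow> homog_deg d g \<Longrightarrow> homog_deg d (f - g)"
  unfolding homog_deg_def using keys_diff[of f g] by blast

lemma homog_deg_mult: "homog_deg d f \<Longrightarrow> homog_deg e g \<Longrightarrow> homog_deg (d + e) (f * g)"
  by (auto simp: homog_deg_def monom_degree_eq elim!: keys_multD)

lemma homog_deg_Var_power: "homog_deg n (Var v ^ n :: 'k::field pol)"
proof (induction n)
  case 0
  show ?case by (simp add: homog_deg_def monom_degree_def)
next
  case (Suc n)
  have "homog_deg 1 (Var v :: 'k pol)"
    by (simp add: homog_deg_def Var_def monom_degree_eq)
  from homog_deg_mult[OF this Suc] show ?case by simp
qed

lemma homog_deg_sum: "(\<And>i. i \<in> Y \<Longrightarrow> homog_deg d (f i)) \<Longrightarrow> homog_deg d (sum f Y)"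
  by (induction Y rule: infinite_finite_induct) (auto simp: homog_deg_def[of d 0] intro: homog_deg_add)

text \<open>Nonzero primes of the principal ideal domain \<open>k[t]\<close> are maximal: a
  generator \<open>r\<close> of \<open>N\<close> divides an element \<open>p\<close> of least degree
  in \<open>M\<close>, and primality puts \<open>r\<close> or the cofactor \<open>s\<close> into
  \<open>M\<close>.\<close>

lemma prime_poly_ideal_maximal:
  fixes M N :: "'k::field poly set"
  assumes sub: "M \<subseteq> N"
    and N_add: "\<And>p q. p \<in> N \<Longrightarrow> q \<in> N \<Longrightarrow> p + q \<in> N"
    and N_mult: "\<And>p q. p \<in> N \<Longrightarrow> q * p \<in> N"
    and M_mult: "\<And>p q. p \<in> M \<Longrightarrow> q * p \<in> M"
    and M_prime: "\<And>p q. p * q \<in> M \<Longrightarrow> p \<in> M \<or> q \<in> M"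
    and proper: "1 \<notin> N"
    and p0: "p0 \<in> M" "p0 \<noteq> 0"
  shows "N \<subseteq> M"
proof -
  obtain p where p: "p \<in> M" "p \<noteq> 0" and p_min: "\<And>q. q \<in> M \<Longrightarrow> q \<noteq> 0 \<Longrightarrow> Polynomial.degree p \<le> Polynomial.degree q"
    using ex_has_least_nat[of "\<lambda>p. p \<in> M \<and> p \<noteq> 0" p0 Polynomial.degree] p0 by blast
  obtain r where r: "r \<in> N" "r \<noteq> 0" and r_min: "\<And>q. q \<in> N \<Longrightarrow> q \<noteq> 0 \<Longrightarrow> Polynomial.degree r \<le> Polynomial.degree q"
    using ex_has_least_nat[of "\<lambda>p. p \<in> N \<and> p \<noteq> 0" p0 Polynomial.degree] p0 sub by blast
  have r_dvd: "r dvd q" if "q \<in> N" for q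
  proof (rule ccontr)
    assume "\<not> r dvd q"
    then have nz: "q mod r \<noteq> 0"
      by (simp add: dvd_eq_mod_eq_0)
    have "q mod r = q + (- (q div r)) * r"
      by (simp add: minus_div_mult_eq_mod [symmetric])
    then have "q mod r \<in> N"
      using N_add N_mult r(1) that by presburger
    then show False
      using r_min[of "q mod r"] degree_mod_less'[OF r(2) nz] nz by simp
  qed
  obtain s where s: "p = r * s"
    using r_dvd p(1) sub by blast
  have "s \<notin> M"
  proof
    assume "s \<in> M"
    moreover have "s \<noteq> 0"
      using p s by auto
    ultimately have "Polynomial.degree r = 0"
      using p_min[of s] r(2) by (simp add: s degree_mult_eq)
    then obtain c where c: "r = [:c:]"
      using degree_eq_zeroE by blast
    with r have "[:inverse c:] * r = 1"
      by simp
    then show False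
      using proper N_mult[OF r(1), of "[:inverse c:]"] by simp
  qed
  then have "r \<in> M"
    using M_prime p(1) s by blast
  then show ?thesis
    using r_dvd M_mult by (metis dvdE mult.commute subsetI)
qed

text \<open>The line is \<open>x = y = 0\<close>, with homogeneous coordinates \<open>z\<close> and
  \<open>w\<close>; on the chart where \<open>w\<close> does not vanish its affine coordinate is
  \<open>t = z/w\<close>.\<close>

locale coord_frame =
  fixes x y z w :: coord
  assumes distinct_coords: "distinct [x, y, z, w]"
begin

lemma UNIV_frame: "UNIV = {x, y, z, w}"
  using distinct_coords by (cases x; cases y; cases z; cases w) (auto simp: UNIV_coord)

text \<open>Dehomogenisation: \<open>x, y \<mapsto> 0\<close>, \<open>z \<mapsto> t\<close>, \<open>w \<mapsto> 1\<close>.\<close>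

definition dehom_term :: "mon \<Rightarrow> 'k::field \<Rightarrow> 'k poly" where
  "dehom_term m c = (Polynomial.monom c (expo m z) when var_degree {x, y} m = 0)"

definition dehom :: "'k::field pol \<Rightarrow> 'k poly" where
  "dehom f = (\<Sum>m\<in>Poly_Mapping.keys f. dehom_term m (Poly_Mapping.lookup f m))"

lemma dehom_term_0 [simp]: "dehom_term m 0 = 0"
  by (simp add: dehom_term_def)

lemma dehom_term_add: "dehom_term m (c + d) = dehom_term m c + dehom_term m d"
  by (simp add: dehom_term_def when_def Polynomial.add_monom)

lemma dehom_term_mult: "dehom_term (m + n) (c * d) = dehom_term m c * dehom_term n d"
  by (simp add: dehom_term_def when_def Polynomial.mult_monom lookup_add)

lemma dehom_superset:
  assumes "finite K" "Poly_Mapping.keys f \<subseteq> K"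
  shows "dehom f = (\<Sum>m\<in>K. dehom_term m (Poly_Mapping.lookup f m))"
  unfolding dehom_def using assms by (intro sum.mono_neutral_left) (auto simp: in_keys_iff)

lemma dehom_add: "dehom (f + g) = dehom f + dehom g"
proof -
  let ?K = "Poly_Mapping.keys f \<union> Poly_Mapping.keys g"
  have "dehom (f + g) = (\<Sum>m\<in>?K. dehom_term m (Poly_Mapping.lookup (f + g) m))"
    "dehom f = (\<Sum>m\<in>?K. dehom_term m (Poly_Mapping.lookup f m))"
    "dehom g = (\<Sum>m\<in>?K. dehom_term m (Poly_Mapping.lookup g m))"
    by (rule dehom_superset; use keys_add[of f g] in auto)+
  then show ?thesis
    by (simp add: lookup_add dehom_term_add sum.distrib)
qed

lemma dehom_0 [simp]: "dehom 0 = 0"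
  by (simp add: dehom_def)

lemma dehom_diff: "dehom (f - g) = dehom f - dehom g"
  using dehom_add[of "f - g" g] by simp

lemma dehom_sum: "dehom (sum f Y) = (\<Sum>i\<in>Y. dehom (f i))"
  by (induction Y rule: infinite_finite_induct) (simp_all add: dehom_add)

lemma dehom_single [simp]: "dehom (Poly_Mapping.single m c) = dehom_term m c"
  by (cases "c = 0") (simp_all add: dehom_def)

lemma dehom_mult: "dehom (f * g) = dehom f * dehom g"
proof -
  have "f * g = (\<Sum>m\<in>Poly_Mapping.keys f. \<Sum>n\<in>Poly_Mapping.keys g.
      Poly_Mapping.single (m + n) (Poly_Mapping.lookup f m * Poly_Mapping.lookup g n))"
    by (subst (1) poly_sum_singles[of f], subst (1) poly_sum_singles[of g])
      (simp add: sum_product mult_single)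
  then show ?thesis
    by (simp add: dehom_sum dehom_term_mult sum_product) (simp add: dehom_def sum_product)
qed

lemma dehom_1 [simp]: "dehom 1 = 1"
  by (simp flip: single_one) (simp add: dehom_term_def)

lemma dehom_w_power [simp]: "dehom (Var w ^ n :: 'k::field pol) = 1"
proof -
  have "dehom (Var w :: 'k pol) = 1"
    using distinct_coords by (auto simp: Var_def dehom_term_def lookup_single when_def)
  then show ?thesis
    by (induction n) (simp_all add: dehom_mult)
qed

text \<open>Homogenisation: the term of degree \<open>i\<close> is padded with a power of
  \<open>w\<close> up to the degree of \<open>p\<close>.\<close>

lemma ex_dehom:
  fixes p :: "'k::field poly"
  obtains f where "homogeneous f" "dehom f = p"
proof
  let ?m = "\<lambda>i. Poly_Mapping.single z i + Poly_Mapping.single w (Polynomial.degree p - i)"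
  let ?f = "\<Sum>i\<le>Polynomial.degree p. Poly_Mapping.single (?m i) (Polynomial.coeff p i)"
  show "homogeneous ?f"
    unfolding homogeneous_iff
    by (rule exI[of _ "Polynomial.degree p"], rule homog_deg_sum)
      (simp add: homog_deg_def monom_degree_eq)
  have "dehom (Poly_Mapping.single (?m i) (Polynomial.coeff p i)) = Polynomial.monom (Polynomial.coeff p i) i" for i
    using distinct_coords by (auto simp: dehom_term_def lookup_add lookup_single when_def)
  then show "dehom ?f = p"
    by (simp add: dehom_sum poly_as_sum_of_monoms)
qed

text \<open>A monomial free of \<open>x\<close> and \<open>y\<close> is determined by its total
  degree and its exponent of \<open>z\<close>. Hence distinct surviving terms of a homogeneous
  \<open>f\<close> go to distinct powers of \<open>t\<close> and cannot cancel, whereas the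
  inhomogeneous \<open>Var w - 1\<close> goes to 0.\<close>

lemma dehom_kernel:
  fixes f :: "'k::field pol"
  assumes "homogeneous f" "dehom f = 0"
  shows "f \<in> var_power {x, y} 1"
proof -
  have "var_degree {x, y} m \<noteq> 0" if m: "m \<in> Poly_Mapping.keys f" for m
  proof
    assume m0: "var_degree {x, y} m = 0"
    have eq: "n = m" if n: "n \<in> Poly_Mapping.keys f" "var_degree {x, y} n = 0" "expo n z = expo m z" for n
    proof -
      have "monom_degree n = monom_degree m"
        using assms(1) m n(1) by (auto simp: homogeneous_def)
      then have "\<forall>v\<in>{x, y, z, w}. expo n v = expo m v"
        using distinct_coords m0 n by (auto simp: monom_degree_def UNIV_frame var_degree_def)
      then have "expo n v = expo m v" for v
        using UNIV_frame by blast
      then show ?thesis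
        by (rule poly_mapping_eqI)
    qed
    have "Polynomial.coeff (dehom f) (expo m z) =
        (\<Sum>n\<in>Poly_Mapping.keys f. Poly_Mapping.lookup f n when n = m)"
      unfolding dehom_def Polynomial.coeff_sum
      using eq m0 by (intro sum.cong) (auto simp: dehom_term_def when_def)
    also have "\<dots> = Poly_Mapping.lookup f m"
      using m by (simp add: when_def)
    finally show False
      using assms(2) m by (simp add: in_keys_iff)
  qed
  then show ?thesis
    by (auto simp: var_power_def mon_ideal_def Suc_le_eq)
qed

text \<open>Restricted to homogeneous elements because \<open>dehom_kernel\<close>, and with it the
  recovery of membership in \<open>Q\<close>, concerns homogeneous polynomials.\<close>

definition dehom_ideal :: "'k::field pol set \<Rightarrow> 'k poly set" where
  "dehom_ideal Q = dehom ` {f \<in> Q. homogeneous f}"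

lemma dehom_idealI: "f \<in> Q \<Longrightarrow> homogeneous f \<Longrightarrow> dehom f \<in> dehom_ideal Q"
  by (simp add: dehom_ideal_def)

context
  fixes Q :: "'k::field pol set"
  assumes prime: "primeideal Q S" and line: "var_power {x, y} 1 \<subseteq> Q" and w: "Var w \<notin> Q"
begin

lemma ideal_Q: "ideal Q S"
  using prime by (simp add: primeideal_S_iff)

lemma w_power_cancel: "Var w ^ n * f \<in> Q \<Longrightarrow> f \<in> Q"
  by (induction n) (use prime w in \<open>auto simp: primeideal_S_iff mult.assoc\<close>)

text \<open>Powers of \<open>w\<close> bring \<open>f\<close> and \<open>h\<close> to the common
  degree \<open>d + e\<close>. Their difference dehomogenises to 0, so it lies in
  \<open>(x, y)\<close> and hence in \<open>Q\<close>; then the power of \<open>w\<close> cancels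
  because \<open>Q\<close> is prime and omits \<open>w\<close>.\<close>

lemma mem_dehom_ideal:
  assumes h: "homogeneous h" "dehom h \<in> dehom_ideal Q"
  shows "h \<in> Q"
proof -
  obtain f where f: "f \<in> Q" "homogeneous f" "dehom f = dehom h"
    using h(2) by (auto simp: dehom_ideal_def)
  obtain d e where de: "homog_deg d f" "homog_deg e h"
    using f(2) h(1) homogeneous_iff by blast
  let ?g = "Var w ^ d * h - Var w ^ e * f"
  have "homog_deg (d + e) ?g"
    using homog_deg_mult[OF homog_deg_Var_power[of d w] de(2)]
      homog_deg_mult[OF homog_deg_Var_power[of e w] de(1)]
    by (auto simp: add.commute intro: homog_deg_diff)
  moreover have "dehom ?g = 0"
    by (simp add: dehom_diff dehom_mult f(3))
  ultimately have "?g \<in> Q"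
    using dehom_kernel homogeneous_iff line by blast
  moreover have "Var w ^ e * f \<in> Q"
    using f(1) ideal_Q by (rule ideal_multD[rotated])
  ultimately have "?g + Var w ^ e * f \<in> Q"
    using ideal_addD[OF ideal_Q] by blast
  then show ?thesis
    using w_power_cancel by simp
qed

lemma dehom_ideal_add:
  assumes "p \<in> dehom_ideal Q" "q \<in> dehom_ideal Q"
  shows "p + q \<in> dehom_ideal Q"
proof -
  obtain f g where fg: "f \<in> Q" "homogeneous f" "dehom f = p" "g \<in> Q" "homogeneous g" "dehom g = q"
    using assms by (auto simp: dehom_ideal_def)
  obtain d e where de: "homog_deg d f" "homog_deg e g"
    using fg homogeneous_iff by blast
  \<comment> \<open>The powers of \<open>w\<close> equalise the degrees and dehomogenise to
    1.\<close>
  let ?h = "Var w ^ e * f + Var w ^ d * g"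
  have "homog_deg (d + e) ?h"
    using homog_deg_mult[OF homog_deg_Var_power[of e w] de(1)]
      homog_deg_mult[OF homog_deg_Var_power[of d w] de(2)]
    by (auto simp: add.commute intro: homog_deg_add)
  moreover have "?h \<in> Q"
    by (intro ideal_addD[OF ideal_Q] ideal_multD[OF ideal_Q] fg)
  moreover have "dehom ?h = p + q"
    by (simp add: dehom_add dehom_mult fg)
  ultimately show ?thesis
    using dehom_idealI homogeneous_iff by metis
qed

lemma dehom_ideal_mult:
  assumes "p \<in> dehom_ideal Q"
  shows "q * p \<in> dehom_ideal Q"
proof -
  obtain f where f: "f \<in> Q" "homogeneous f" "dehom f = p"
    using assms by (auto simp: dehom_ideal_def)
  obtain g :: "'k pol" where g: "homogeneous g" "dehom g = q"
    by (rule ex_dehom)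
  have "homogeneous (g * f)"
    using f g homog_deg_mult homogeneous_iff by metis
  moreover have "g * f \<in> Q"
    using f(1) ideal_Q by (rule ideal_multD[rotated])
  moreover have "dehom (g * f) = q * p"
    by (simp add: dehom_mult f g)
  ultimately show ?thesis
    using dehom_idealI by metis
qed

lemma dehom_ideal_prime:
  assumes "p * q \<in> dehom_ideal Q"
  shows "p \<in> dehom_ideal Q \<or> q \<in> dehom_ideal Q"
proof -
  obtain f g :: "'k pol" where f: "homogeneous f" "dehom f = p" and g: "homogeneous g" "dehom g = q"
    using ex_dehom by metis
  have "homogeneous (f * g)"
    using f g homog_deg_mult homogeneous_iff by metis
  then have "f * g \<in> Q"
    using assms f g by (intro mem_dehom_ideal) (auto simp: dehom_mult)
  then have "f \<in> Q \<or> g \<in> Q"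
    using prime by (simp add: primeideal_S_iff)
  then show ?thesis
    using f g dehom_idealI by metis
qed

lemma one_notin_dehom_ideal: "1 \<notin> dehom_ideal Q"
proof
  assume "1 \<in> dehom_ideal Q"
  then have "1 \<in> Q"
    by (intro mem_dehom_ideal) (auto simp: homogeneous_def)
  with prime show False
    by (simp add: primeideal_S_iff)
qed

end

text \<open>Both primes yield proper prime ideals of \<open>k[t]\<close>, the smaller one nonzero
  because \<open>Q1\<close> is strictly larger than \<open>(x, y)\<close>. Maximality makes the two
  coincide, and \<open>mem_dehom_ideal\<close> carries this back to the homogeneous elements of
  \<open>Q2\<close>.\<close>

lemma no_long_chain_frame:
  fixes Q1 Q2 :: "'k::field pol set"
  assumes "primeideal Q1 S" "primeideal Q2 S" "homogeneous_ideal Q1" "homogeneous_ideal Q2"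
    and "Q1 \<subset> Q2" "var_power {x, y} 1 \<subset> Q1" "Var w \<notin> Q2"
  shows False
proof -
  \<comment> \<open>A homogeneous ideal is generated by its homogeneous elements, so one of them
    witnesses a failure of inclusion.\<close>
  have new: "\<exists>f\<in>Q. homogeneous f \<and> f \<notin> P" if "ideal P S" "homogeneous_ideal Q" "\<not> Q \<subseteq> P" for P Q :: "'k pol set"
  proof (rule ccontr)
    assume "\<not> ?thesis"
    then have "{f \<in> Q. homogeneous f} \<subseteq> P"
      by blast
    then have "Idl\<^bsub>S\<^esub> {f \<in> Q. homogeneous f} \<subseteq> P"
      by (rule S.genideal_minimal[OF that(1)])
    then show False
      using that(2,3) unfolding homogeneous_ideal_def by blast
  qed
  have w1: "Var w \<notin> Q1" and l1: "var_power {x, y} 1 \<subseteq> Q1" and l2: "var_power {x, y} 1 \<subseteq> Q2"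
    using assms by auto
  obtain f where f: "f \<in> Q1" "homogeneous f" "f \<notin> var_power {x, y} 1"
    using new[OF ideal_var_power[of "{x, y}" 1] assms(3)] assms(6) by blast
  obtain g where g: "g \<in> Q2" "homogeneous g" "g \<notin> Q1"
    using new[OF ideal_Q[OF assms(1) l1 w1] assms(4)] assms(5) by blast
  have "dehom_ideal Q2 \<subseteq> dehom_ideal Q1"
  proof (rule prime_poly_ideal_maximal)
    show "dehom_ideal Q1 \<subseteq> dehom_ideal Q2"
      using assms(5) by (auto simp: dehom_ideal_def)
    show "dehom f \<in> dehom_ideal Q1"
      using f by (auto simp: dehom_ideal_def)
    show "dehom f \<noteq> 0"
      using f dehom_kernel by blast
  qed (use dehom_ideal_add dehom_ideal_mult dehom_ideal_prime one_notin_dehom_ideal assms w1 l1 l2 in blast)+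
  then have "dehom g \<in> dehom_ideal Q1"
    using g by (auto simp: dehom_ideal_def)
  then show False
    using mem_dehom_ideal[OF assms(1) l1 w1] g by blast
qed

end

section \<open>Dimension of closed subsets of \<open>Proj\<close>\<close>

lemma irrelevant_ideal_eq: "irrelevant_ideal = (var_power UNIV 1 :: 'k::field pol set)"
  unfolding irrelevant_ideal_def by (rule genideal_vars)

lemma var_power_subset_iff:
  fixes J :: "'k::field pol set"
  assumes "ideal J S"
  shows "var_power V 1 \<subseteq> J \<longleftrightarrow> Var ` V \<subseteq> J"
proof
  assume "Var ` V \<subseteq> J"
  then show "var_power V 1 \<subseteq> J"
    unfolding genideal_vars[symmetric] by (rule S.genideal_minimal[OF assms])
qed (auto simp: subset_iff)

lemma ex_coord_notin:
  obtains v :: coord where "v \<notin> {x, y, z}"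
proof -
  have "card {x, y, z} \<le> 3"
    using card_length[of "[x, y, z]"] by simp
  moreover have "card (UNIV :: coord set) = 4"
    by (simp add: UNIV_coord)
  ultimately have "{x, y, z} \<noteq> UNIV"
    by auto
  then show ?thesis
    using that by blast
qed

text \<open>A point of \<open>Proj\<close> omits some variable. Choosing \<open>w\<close> outside
  the largest prime \<open>Q2\<close> gives a chart that meets all three points of the
  chain.\<close>

lemma no_long_chain:
  fixes Q0 Q1 Q2 :: "'k::field pol set"
  assumes "Q0 \<in> proj_points" "Q1 \<in> proj_points" "Q2 \<in> proj_points" "Q0 \<subset> Q1" "Q1 \<subset> Q2"
    and "x \<noteq> y" "Var x \<in> Q0" "Var y \<in> Q0"
  shows False
proof -
  have I: "ideal Q0 S" "ideal Q2 S"
    using assms unfolding proj_points_def homogeneous_ideal_def by blast+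
  have "\<not> range Var \<subseteq> Q2"
    using assms(3) I var_power_subset_iff[of Q2 UNIV] by (simp add: proj_points_def irrelevant_ideal_eq)
  then obtain w where w: "Var w \<notin> Q2"
    by blast
  have "w \<noteq> x" "w \<noteq> y"
    using assms w by auto
  obtain z where "z \<notin> {x, y, w}"
    by (rule ex_coord_notin)
  then interpret coord_frame x y z w
    using assms(6) \<open>w \<noteq> x\<close> \<open>w \<noteq> y\<close> by unfold_locales auto
  \<comment> \<open>Strict because \<open>(x, y)\<close> already lies in \<open>Q0\<close>.\<close>
  have "var_power {x, y} 1 \<subset> Q1"
    using var_power_subset_iff[OF I(1), of "{x, y}"] assms by blast
  then show False
    using no_long_chain_frame[of Q1 Q2] assms w unfolding proj_points_def by blast
qed

lemma vars_proj_point: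
  assumes "w \<notin> V"
  shows "(var_power V 1 :: 'k::field pol set) \<in> proj_points"
proof -
  have "\<not> var_power UNIV 1 \<subseteq> (var_power V 1 :: 'k pol set)"
    using assms var_power_subset_iff[OF ideal_var_power, of UNIV V 1] by (auto simp: image_subset_iff)
  then show ?thesis
    using primeideal_vars homogeneous_mon_ideal[OF up_closed_var_degree, of 1 V]
    by (auto simp: proj_points_def irrelevant_ideal_eq var_power_def)
qed

text \<open>The chain from \<open>(x, y)\<close> to \<open>(x, y, z)\<close> gives the lower bound;
  both are points of \<open>Proj\<close> because they omit \<open>w\<close>. The upper bound is
  \<open>no_long_chain\<close>, applied to the first three members of a longer chain.\<close>

lemma proj_dim_eq_1:
  fixes J :: "'k::field pol set"
  assumes "J \<subseteq> var_power {x, y} 1"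
    and "\<And>Q. primeideal Q S \<Longrightarrow> J \<subseteq> Q \<Longrightarrow> \<exists>x y. x \<noteq> y \<and> Var x \<in> Q \<and> Var y \<in> Q"
  shows "proj_dim J = 1"
proof -
  let ?chain = "\<lambda>n Q. (\<forall>i\<le>n. Q i \<in> proj_points \<and> J \<subseteq> Q i) \<and> (\<forall>i<n. Q i \<subset> Q (Suc i))"
  have le: "n \<le> 1" if "?chain n Q" for n and Q :: "nat \<Rightarrow> 'k pol set"
  proof (rule ccontr)
    assume "\<not> n \<le> 1"
    then have Q: "Q 0 \<in> proj_points" "Q 1 \<in> proj_points" "Q 2 \<in> proj_points" "Q 0 \<subset> Q 1" "Q 1 \<subset> Q 2" "J \<subseteq> Q 0"
      using that by (auto simp: numeral_2_eq_2)
    then obtain x y where "x \<noteq> y" "Var x \<in> Q 0" "Var y \<in> Q 0"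
      using assms(2)[of "Q 0"] unfolding proj_points_def by blast
    with Q show False
      using no_long_chain by blast
  qed
  obtain z where z: "z \<notin> {x, y, y}"
    by (rule ex_coord_notin)
  obtain w where w: "w \<notin> {x, y, z}"
    by (rule ex_coord_notin)
  define Q where "Q i = (var_power (if i = 0 then {x, y} else {x, y, z}) 1 :: 'k pol set)" for i :: nat
  have sub: "var_power {x, y} 1 \<subset> (var_power {x, y, z} 1 :: 'k pol set)"
  proof
    show "var_power {x, y} 1 \<subseteq> (var_power {x, y, z} 1 :: 'k pol set)"
      using var_power_subset_iff[OF ideal_var_power, of "{x, y}" "{x, y, z}" 1] by auto
    have "(Var z :: 'k pol) \<in> var_power {x, y, z} 1" "(Var z :: 'k pol) \<notin> var_power {x, y} 1"
      using z by auto
    then show "var_power {x, y} 1 \<noteq> (var_power {x, y, z} 1 :: 'k pol set)"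
      by metis
  qed
  have "?chain 1 Q"
    using sub assms(1) vars_proj_point[of w "{x, y}"] vars_proj_point[of w "{x, y, z}"] w
    by (auto simp: Q_def)
  then have "1 \<le> proj_dim J"
    unfolding proj_dim_def by (intro Sup_upper) (use one_enat_def in blast)
  moreover have "proj_dim J \<le> 1"
    unfolding proj_dim_def
  proof (rule Sup_least)
    fix d
    assume "d \<in> {enat n | n. \<exists>Q. ?chain n Q}"
    then obtain n Q where "d = enat n" "?chain n Q"
      by blast
    then show "d \<le> 1"
      using le[of n Q] by (simp add: one_enat_def)
  qed
  ultimately show ?thesis
    by (rule antisym[rotated])
qed

section \<open>Intersections of powers of the six line ideals\<close>

text \<open>Edges of the coordinate tetrahedron are two-element sets, which makes the weights
  symmetric and lets all four vertices be treated alike.\<close>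

definition tet_mons :: "(coord set \<Rightarrow> nat) \<Rightarrow> mon set" where
  "tet_mons e = {m. \<forall>x y. x \<noteq> y \<longrightarrow> e {x, y} \<le> expo m x + expo m y}"

abbreviation tet_ideal :: "(coord set \<Rightarrow> nat) \<Rightarrow> 'k::field pol set" where
  "tet_ideal e \<equiv> mon_ideal (tet_mons e)"

lemma up_closed_tet_mons: "up_closed (tet_mons e)"
  unfolding up_closed_def
proof (intro ballI allI)
  fix m n :: mon
  assume "m \<in> tet_mons e"
  then have "e {x, y} \<le> expo m x + expo m y" if "x \<noteq> y" for x y
    using that by (simp add: tet_mons_def)
  then have "e {x, y} \<le> expo (n + m) x + expo (n + m) y" if "x \<noteq> y" for x y
    using that by (fastforce simp: lookup_add intro: order_trans)
  then show "n + m \<in> tet_mons e"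
    by (simp add: tet_mons_def)
qed

lemma ideal_tet_ideal: "ideal (tet_ideal e :: 'k::field pol set) S"
  by (rule ideal_mon_ideal[OF up_closed_tet_mons])

text \<open>Exhibits the intersection of primary ideals, so that \<open>var_power_primary\<close>
  can be applied to each component.\<close>

lemma tet_ideal_iff:
  "f \<in> tet_ideal e \<longleftrightarrow> (\<forall>x y. x \<noteq> y \<longrightarrow> f \<in> var_power {x, y} (e {x, y}))"
proof -
  have "var_degree {x, y} m = expo m x + expo m y" if "x \<noteq> y" for x y m
    using that by (simp add: var_degree_def)
  then show ?thesis
    unfolding mon_ideal_def tet_mons_def var_power_def by (simp add: subset_iff) blast
qed

section \<open>Primes over a tetrahedral ideal, saturation and associated primes\<close>

lemma Var_power_eq: "(Var v ^ n :: 'k::field pol) = Poly_Mapping.single (Poly_Mapping.single v n) 1"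
proof (induction n)
  case (Suc n)
  then show ?case
    by (simp add: Var_def mult_single flip: single_add)
qed simp

lemma prod_Var_powers:
  "(\<Prod>v\<in>V. Var v ^ k v :: 'k::field pol) = Poly_Mapping.single (\<Sum>v\<in>V. Poly_Mapping.single v (k v)) 1"
  by (induction V rule: infinite_finite_induct) (simp_all add: Var_power_eq mult_single)

lemma expo_sum_single:
  "expo (\<Sum>v\<in>V. Poly_Mapping.single v (k v)) w = (k w when w \<in> V)"
  by (auto simp: lookup_sum lookup_single when_def)

lemma prime_power_mem: "primeideal Q S \<Longrightarrow> f ^ n \<in> Q \<Longrightarrow> f \<in> Q" for Q :: "'k::field pol set"
  by (induction n) (auto simp: primeideal_S_iff)

lemma prime_prod_mem:
  fixes Q :: "'k::field pol set"
  shows "primeideal Q S \<Longrightarrow> prod f V \<in> Q \<Longrightarrow> \<exists>v\<in>V. f v \<in> Q"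
  by (induction V rule: infinite_finite_induct) (auto simp: primeideal_S_iff)

text \<open>If every edge of positive weight had an end not in \<open>Q\<close>, then a power of the product of the
  variables outside \<open>Q\<close> would lie in \<open>tet_ideal e \<subseteq> Q\<close>.\<close>

lemma prime_contains_line:
  fixes Q :: "'k::field pol set"
  assumes Q: "primeideal Q S" and sub: "tet_ideal e \<subseteq> Q"
  shows "\<exists>x y. x \<noteq> y \<and> Var x \<in> Q \<and> Var y \<in> Q"
proof (rule ccontr)
  assume "\<not> ?thesis"
  then have none: "Var x \<notin> Q \<or> Var y \<notin> Q" if "x \<noteq> y" for x y
    using that by blast
  \<comment> \<open>A common bound for all weights; the sum is finite since \<open>coord\<close> is
    a finite type.\<close>
  define N where "N = (\<Sum>E\<in>UNIV. e E)"
  have N: "e E \<le> N" for E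
    unfolding N_def by (rule member_le_sum) auto
  define V where "V = {v. (Var v :: 'k pol) \<notin> Q}"
  \<comment> \<open>At least one end of every edge lies in \<open>V\<close> and contributes
    \<open>N\<close>.\<close>
  have "e {x, y} \<le> (N when x \<in> V) + (N when y \<in> V)" if "x \<noteq> y" for x y
    using none[OF that] N[of "{x, y}"] by (auto simp: V_def when_def intro: trans_le_add1 trans_le_add2)
  then have "(\<Prod>v\<in>V. Var v ^ N :: 'k pol) \<in> tet_ideal e"
    by (simp add: prod_Var_powers tet_mons_def expo_sum_single)
  then have "(\<Prod>v\<in>V. Var v ^ N :: 'k pol) \<in> Q"
    using sub by blast
  then obtain v where "v \<in> V" "(Var v ^ N :: 'k pol) \<in> Q"
    using prime_prod_mem[OF Q] by blast
  then show False
    using prime_power_mem[OF Q] by (auto simp: V_def)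
qed

text \<open>For each edge some variable \<open>z\<close> off it has its \<open>n\<close>-th power
  outside \<open>(x, y)\<close> but in the \<open>n\<close>-th power of the irrelevant ideal;
  primariness cancels that power.\<close>

lemma saturation_tet_ideal: "saturation (tet_ideal e) = (tet_ideal e :: 'k::field pol set)"
proof
  show "tet_ideal e \<subseteq> saturation (tet_ideal e :: 'k pol set)"
    using ideal_multD[OF ideal_tet_ideal] by (auto simp: saturation_def intro: exI[of _ 0])
  show "saturation (tet_ideal e) \<subseteq> (tet_ideal e :: 'k pol set)"
  proof
    fix f :: "'k pol"
    assume "f \<in> saturation (tet_ideal e)"
    then obtain n where n: "g * f \<in> tet_ideal e" if "g \<in> var_power UNIV n" for g
      unfolding saturation_def irrelevant_ideal_eq ideal_power_vars by blast
    show "f \<in> tet_ideal e"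
      unfolding tet_ideal_iff
    proof (intro allI impI)
      fix x y :: coord
      assume xy: "x \<noteq> y"
      obtain z where z: "z \<notin> {x, y, y}"
        by (rule ex_coord_notin)
      let ?g = "Var z ^ n :: 'k pol"
      have "?g \<in> var_power UNIV n"
        by (simp add: Var_power_eq var_power_def)
      then have "?g * f \<in> var_power {x, y} (e {x, y})"
        using n xy tet_ideal_iff by blast
      moreover have "?g \<notin> var_power {x, y} 1"
        using z by (simp add: Var_power_eq var_power_def)
      ultimately show "f \<in> var_power {x, y} (e {x, y})"
        by (rule var_power_primary)
    qed
  qed
qed

text \<open>If \<open>P\<close> annihilates \<open>f\<close>, then \<open>f\<close> fails membership
  in some component, and primariness forces \<open>P\<close> into its radical \<open>(x, y)\<close>.
  Conversely \<open>P\<close> contains the tetrahedral ideal, hence two variables, which can only be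
  \<open>x\<close> and \<open>y\<close>.\<close>

lemma associated_primes_tet_ideal:
  fixes P :: "'k::field pol set"
  assumes "P \<in> associated_primes (tet_ideal e)"
  obtains x y where "x \<noteq> y" "P = var_power {x, y} 1"
proof -
  obtain f where P: "primeideal P S" "P = {g. g * f \<in> tet_ideal e}"
    using assms by (auto simp: associated_primes_def)
  then have "f \<notin> tet_ideal e"
    by (auto simp: primeideal_S_iff)
  then obtain x y where xy: "x \<noteq> y" "f \<notin> var_power {x, y} (e {x, y})"
    using tet_ideal_iff by blast
  have sub: "P \<subseteq> var_power {x, y} 1"
  proof
    fix g assume "g \<in> P"
    then have "g * f \<in> var_power {x, y} (e {x, y})"
      using P(2) xy tet_ideal_iff by blast
    then show "g \<in> var_power {x, y} 1"
      using var_power_primary xy(2) by blast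
  qed
  have "tet_ideal e \<subseteq> P"
    unfolding P(2) using ideal_multD[OF ideal_tet_ideal] by (auto simp: mult.commute[of _ f])
  then obtain u v where uv: "u \<noteq> v" "Var u \<in> P" "Var v \<in> P"
    using prime_contains_line[OF P(1)] by blast
  then have "(Var u :: 'k pol) \<in> var_power {x, y} 1" "(Var v :: 'k pol) \<in> var_power {x, y} 1"
    using sub by blast+
  then have "{x, y} = {u, v}"
    using uv(1) by auto
  then have "var_power {x, y} 1 \<subseteq> P"
    using var_power_subset_iff[of P "{x, y}"] P(1) uv by (auto simp: primeideal_S_iff)
  with sub xy(1) show ?thesis
    using that by blast
qed

text \<open>An edge of positive weight puts a whole line into the zero set, so the dimension is not
  below 1. All associated primes are line ideals, whose dimension is 1 by the same
  criterion.\<close>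

lemma unmixed_tet_ideal:
  assumes "x \<noteq> y" "0 < e {x, y}"
  shows "unmixed_curve_ideal (tet_ideal e :: 'k::field pol set)"
proof -
  have "var_power {x, y} (e {x, y}) \<subseteq> (var_power {x, y} 1 :: 'k pol set)"
    using assms(2) by (auto simp: var_power_def mon_ideal_def subset_iff)
  then have sub: "tet_ideal e \<subseteq> (var_power {x, y} 1 :: 'k pol set)"
    using assms(1) tet_ideal_iff by blast
  have dim: "proj_dim (tet_ideal e :: 'k pol set) = 1"
    by (rule proj_dim_eq_1[OF sub prime_contains_line])
  have "proj_dim P = 1" if "P \<in> associated_primes (tet_ideal e)" for P :: "'k pol set"
  proof -
    obtain u v where uv: "u \<noteq> v" "P = var_power {u, v} 1"
      using associated_primes_tet_ideal[OF \<open>P \<in> _\<close>] .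
    have "Var u \<in> P" "Var v \<in> P"
      by (simp_all add: uv)
    then have "\<exists>x y. x \<noteq> y \<and> Var x \<in> Q \<and> Var y \<in> Q" if "P \<subseteq> Q" for Q
      using uv(1) that by blast
    then show ?thesis
      using uv(2) by (intro proj_dim_eq_1[of P u v]) auto
  qed
  then show ?thesis
    using dim homogeneous_mon_ideal[OF up_closed_tet_mons] saturation_tet_ideal
    by (auto simp: unmixed_curve_ideal_def)
qed

section \<open>Basic double links at a vertex\<close>

lemma monomial_dvd_iff: "(\<exists>n. m = n + u) \<longleftrightarrow> (\<forall>w. expo u w \<le> expo m w)" for m u :: mon
proof
  assume "\<forall>w. expo u w \<le> expo m w"
  then have "m = (m - u) + u"
    by (intro poly_mapping_eqI) (simp add: lookup_add lookup_minus)
  then show "\<exists>n. m = n + u" ..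
qed (auto simp: lookup_add)

lemma ideal_PIdl_S: "ideal (PIdl\<^bsub>S\<^esub> F) S" for F :: "'k::field pol"
  by (rule S.cgenideal_ideal) simp

lemma PIdl_monomial:
  "PIdl\<^bsub>S\<^esub> (Poly_Mapping.single u 1 :: 'k::field pol) = mon_ideal {m. \<forall>w. expo u w \<le> expo m w}"
    (is "?P = ?M")
proof
  show "?P \<subseteq> ?M"
    by (auto simp: PIdl_S mon_ideal_def lookup_add elim!: keys_multD)
  show "?M \<subseteq> ?P"
  proof (rule mon_ideal_subset[OF ideal_PIdl_S])
    fix m assume "m \<in> {m. \<forall>w. expo u w \<le> expo m w}"
    then obtain n where "m = n + u"
      using monomial_dvd_iff[of m u] by auto
    then have "Poly_Mapping.single m 1 = Poly_Mapping.single n 1 * (Poly_Mapping.single u 1 :: 'k pol)"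
      by (simp add: mult_single)
    then show "Poly_Mapping.single m (1::'k) \<in> ?P"
      unfolding PIdl_S by blast
  qed
qed

lemma lookup_single_mult:
  fixes f :: "'k::field pol"
  shows "Poly_Mapping.lookup (Poly_Mapping.single s 1 * f) (s + k) = Poly_Mapping.lookup f k"
proof -
  have "Poly_Mapping.single s 1 * f = (\<Sum>m\<in>Poly_Mapping.keys f. Poly_Mapping.single (s + m) (Poly_Mapping.lookup f m))"
    by (subst (1) poly_sum_singles[of f]) (simp add: sum_distrib_left mult_single)
  then show ?thesis
    by (auto simp: lookup_sum lookup_single when_def in_keys_iff)
qed

text \<open>As \<open>v\<close> does not occur in the monomial, multiplying by \<open>v\<close> does
  not change which terms it divides. Being nonconstant, the monomial lies in the irrelevant ideal,
  as does \<open>v\<close>, so the two generate a proper ideal.\<close>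

lemma regular_sequence2_monomial_Var:
  assumes "expo u v = 0" "u \<noteq> 0"
  shows "regular_sequence2 (Poly_Mapping.single u 1 :: 'k::field pol) (Var v)"
  unfolding regular_sequence2_def
proof (intro conjI allI impI)
  fix h :: "'k pol"
  assume "Poly_Mapping.single u 1 * h = 0"
  moreover have "Poly_Mapping.single u (1::'k) \<noteq> 0"
    by (metis keys_eq_empty keys_single insert_not_empty zero_neq_one)
  ultimately show "h = 0"
    by simp
next
  fix h :: "'k pol"
  assume h: "Var v * h \<in> PIdl\<^bsub>S\<^esub> (Poly_Mapping.single u 1)"
  have "expo u w \<le> expo k w" if k: "k \<in> Poly_Mapping.keys h" for k w
  proof -
    have "Poly_Mapping.single v 1 + k \<in> Poly_Mapping.keys (Var v * h)"
      using k by (simp add: in_keys_iff Var_def lookup_single_mult)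
    then have "expo u w \<le> expo (Poly_Mapping.single v 1 + k) w"
      using h unfolding PIdl_monomial mon_ideal_def by blast
    then show ?thesis
      using assms(1) by (cases "w = v") (auto simp: lookup_add lookup_single)
  qed
  then show "h \<in> PIdl\<^bsub>S\<^esub> (Poly_Mapping.single u 1)"
    unfolding PIdl_monomial by (auto simp: mon_ideal_def)
next
  obtain w where "expo u w \<noteq> 0"
    using assms(2) by (metis lookup_zero poly_mapping_eqI)
  then have "0 < expo u w"
    by simp
  then have "(Poly_Mapping.single u 1 :: 'k pol) \<in> var_power UNIV 1"
    using member_le_sum[of w UNIV "expo u"] by (simp add: var_power_def var_degree_def)
  then have "Idl\<^bsub>S\<^esub> {Poly_Mapping.single u 1, Var v} \<subseteq> (var_power UNIV 1 :: 'k pol set)"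
    by (intro S.genideal_minimal[OF ideal_var_power]) auto
  moreover have "(1 :: 'k pol) \<notin> var_power UNIV 1"
    by (simp add: var_power_def mon_ideal_def)
  ultimately show "Idl\<^bsub>S\<^esub> {Poly_Mapping.single u 1, Var v :: 'k pol} \<noteq> carrier S"
    by auto
qed

lemma ideal_mult_image:
  fixes J :: "'k::field pol set"
  assumes "ideal J S"
  shows "ideal ((\<lambda>h. G * h) ` J) S"
  unfolding ideal_S_iff
proof (intro conjI ballI allI)
  show "0 \<in> (\<lambda>h. G * h) ` J"
    using assms by (force simp: ideal_S_iff)
next
  fix f g assume "f \<in> (\<lambda>h. G * h) ` J" "g \<in> (\<lambda>h. G * h) ` J"
  then obtain f' g' where "f' \<in> J" "g' \<in> J" "f = G * f'" "g = G * g'"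
    by blast
  then show "f + g \<in> (\<lambda>h. G * h) ` J"
    using ideal_addD[OF assms] by (intro image_eqI[of _ _ "f' + g'"]) (auto simp: distrib_left)
next
  fix f g assume "f \<in> (\<lambda>h. G * h) ` J"
  then obtain f' where "f' \<in> J" "f = G * f'"
    by blast
  then show "g * f \<in> (\<lambda>h. G * h) ` J"
    using ideal_multD[OF assms] by (intro image_eqI[of _ _ "g * f'"]) (auto simp: mult.left_commute)
qed

lemma set_add_S: "H <+>\<^bsub>S\<^esub> K = {h + k | h k. h \<in> H \<and> k \<in> K}" for H K :: "'k::field pol set"
  by (auto simp: set_add_def')

text \<open>The common form of the four equivalences: truncated subtraction expresses
  \<open>max{0, n - 1}\<close> on the edges through \<open>v\<close>, and the edges of the opposite
  face keep their weight.\<close>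

proposition basic_double_link_at_vertex:
  fixes e e' :: "coord set \<Rightarrow> nat" and v :: coord
  defines "F \<equiv> \<Prod>w\<in>-{v}. (Var w :: 'k::field pol) ^ e {v, w}"
  assumes nontrivial: "\<exists>x y. x \<noteq> y \<and> 0 < e {x, y}"
    and at: "\<forall>w. w \<noteq> v \<longrightarrow> e' {v, w} = e {v, w} - 1"
    and off: "\<forall>w u. w \<noteq> v \<longrightarrow> u \<noteq> v \<longrightarrow> w \<noteq> u \<longrightarrow> e' {w, u} = e {w, u}"
  shows "(\<forall>w u. w \<noteq> v \<longrightarrow> u \<noteq> v \<longrightarrow> w \<noteq> u \<longrightarrow> e {w, u} \<le> e {v, w} + e {v, u}) \<longleftrightarrow>
    basic_double_link (tet_ideal e) (tet_ideal e') F (Var v)"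
    (is "?tri \<longleftrightarrow> ?bdl")
proof
  note e'_at = at[rule_format] and e'_off = off[rule_format]
  define q where "q = (\<Sum>w\<in>-{v}. Poly_Mapping.single w (e {v, w}))"
  have F: "F = Poly_Mapping.single q 1"
    unfolding F_def q_def by (rule prod_Var_powers)
  have q: "expo q w = (if w = v then 0 else e {v, w})" for w
    by (simp add: q_def expo_sum_single when_def)
  {
    assume ?bdl
    \<comment> \<open>This is \<open>F \<in> I'\<close>; on an edge of the face opposite to
      \<open>v\<close> it reads as a triangle inequality.\<close>
    then have "q \<in> tet_mons e'"
      by (simp add: basic_double_link_def F)
    then show ?tri
      unfolding tet_mons_def using e'_off q by fastforce
  next
    assume tri: ?tri
    have e'_at': "e' {w, v} = e {v, w} - 1" if "w \<noteq> v" for w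
      using e'_at[OF that] by (simp add: insert_commute)
    have tet_iff: "m \<in> tet_mons d \<longleftrightarrow> (\<forall>w. w \<noteq> v \<longrightarrow> d {v, w} \<le> expo m v + expo m w) \<and>
        (\<forall>w u. w \<noteq> v \<longrightarrow> u \<noteq> v \<longrightarrow> w \<noteq> u \<longrightarrow> d {w, u} \<le> expo m w + expo m u)" (is "_ = ?r") for m d
    proof
      assume r: ?r
      have "d {x, y} \<le> expo m x + expo m y" if "x \<noteq> y" for x y
      proof -
        consider "x = v" | "y = v" | "x \<noteq> v" "y \<noteq> v"
          by blast
        then show ?thesis
        proof cases
          case 1
          then show ?thesis using r that by simp
        next
          case 2
          then have "d {v, x} \<le> expo m v + expo m x" using r that by simp
          then show ?thesis using 2 by (simp add: insert_commute add.commute)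
        next
          case 3
          then show ?thesis using r that by simp
        qed
      qed
      then show "m \<in> tet_mons d"
        by (simp add: tet_mons_def)
    qed (auto simp: tet_mons_def)
    have q_e: "q \<in> tet_mons e"
      using tri by (auto simp: tet_iff q)
    \<comment> \<open>Lowering weights only weakens the conditions.\<close>
    then have q_e': "q \<in> tet_mons e'"
      by (auto simp: tet_iff q e'_at e'_off)
    \<comment> \<open>A factor \<open>v\<close> raises the left exponent sum by one on exactly the
      edges through \<open>v\<close>; \<open>n \<le> Suc s\<close> and \<open>n - 1 \<le> s\<close>
      are equivalent even for \<open>n = 0\<close>.\<close>
    have shift: "Poly_Mapping.single v 1 + m \<in> tet_mons e \<longleftrightarrow> m \<in> tet_mons e'" for m
    proof -
      have "e {v, w} \<le> Suc (expo m v) + expo m w \<longleftrightarrow> e' {v, w} \<le> expo m v + expo m w" if "w \<noteq> v" for w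
        using e'_at[OF that] by auto
      then show ?thesis
        using e'_off by (auto simp: tet_iff lookup_add lookup_single)
    qed
    \<comment> \<open>If all weights at \<open>v\<close> vanished, the triangle inequalities would
      make the remaining weights vanish too.\<close>
    have "q \<noteq> 0"
    proof
      assume "q = 0"
      then have q0: "e {v, w} = 0" if "w \<noteq> v" for w
        using q[of w] that by simp
      obtain x y where xy: "x \<noteq> y" "0 < e {x, y}"
        using nontrivial by blast
      have "x \<noteq> v" "y \<noteq> v"
        using xy q0[of x] q0[of y] by (auto simp: insert_commute)
      then have "e {x, y} \<le> e {v, x} + e {v, y}"
        using tri xy by blast
      then show False
        using q0[of x] q0[of y] xy \<open>x \<noteq> v\<close> \<open>y \<noteq> v\<close> by simp
    qed
    then have regular: "regular_sequence2 F (Var v)"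
      unfolding F by (intro regular_sequence2_monomial_Var) (simp_all add: q)
    \<comment> \<open>All weights of \<open>e'\<close> may be zero; then \<open>I'\<close> is the
      unit ideal of the trivial curve.\<close>
    have curve: "tet_ideal e' = carrier (S :: 'k pol ring) \<or> unmixed_curve_ideal (tet_ideal e' :: 'k pol set)"
    proof (cases "\<exists>x y. x \<noteq> y \<and> 0 < e' {x, y}")
      case True
      then show ?thesis
        using unmixed_tet_ideal by blast
    next
      case False
      then have "e' {x, y} = 0" if "x \<noteq> y" for x y
        using that neq0_conv by blast
      then have "tet_mons e' = UNIV"
        by (simp add: tet_mons_def)
      then show ?thesis
        by (simp add: mon_ideal_def)
    qed
    let ?G = "Var v :: 'k pol"
    let ?R = "((\<lambda>h. ?G * h) ` tet_ideal e') <+>\<^bsub>S\<^esub> (PIdl\<^bsub>S\<^esub> F)"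
    have R_ideal: "ideal ?R S"
      by (intro S.add_ideals ideal_mult_image ideal_tet_ideal ideal_PIdl_S)
    have memR: "?G * h + k * F \<in> ?R" if "h \<in> tet_ideal e'" for h k
      unfolding set_add_S PIdl_S using that by blast
    have "tet_ideal e = ?R"
    proof
      show "tet_ideal e \<subseteq> ?R"
      proof (rule mon_ideal_subset[OF R_ideal])
        fix m assume m: "m \<in> tet_mons e"
        show "Poly_Mapping.single m 1 \<in> ?R"
        proof (cases "expo m v = 0")
          case True
          \<comment> \<open>With exponent 0 at \<open>v\<close>, the condition on the edge
            \<open>{v, w}\<close> falls on \<open>w\<close> alone, so \<open>F\<close> divides the
            monomial.\<close>
          then have "\<forall>w. expo q w \<le> expo m w"
            using m by (auto simp: q tet_iff)
          then obtain n where "m = n + q"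
            using monomial_dvd_iff by blast
          then have "Poly_Mapping.single m 1 = ?G * 0 + Poly_Mapping.single n 1 * F"
            by (simp add: F mult_single)
          moreover have "(0 :: 'k pol) \<in> tet_ideal e'"
            by (simp add: mon_ideal_def)
          ultimately show ?thesis
            using memR by metis
        next
          case False
          then have "0 < expo m v"
            by simp
          then obtain n where n: "m = n + Poly_Mapping.single v 1"
            by (rule monomial_remove_var)
          then have "(Poly_Mapping.single n 1 :: 'k pol) \<in> tet_ideal e'"
            using m shift[of n] by (simp add: add.commute)
          moreover have "Poly_Mapping.single m 1 = ?G * Poly_Mapping.single n 1 + 0 * F"
            by (simp add: n Var_def mult_single add.commute)
          ultimately show ?thesis
            using memR by metis
        qed
      qed
      have "?G * h \<in> tet_ideal e" if "h \<in> tet_ideal e'" for h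
        using that shift unfolding mon_ideal_def Var_def by (auto elim!: keys_multD)
      moreover have "F \<in> tet_ideal e"
        using q_e by (simp add: F)
      ultimately have "?G * h + k * F \<in> tet_ideal e" if "h \<in> tet_ideal e'" for h k
        using that by (intro ideal_addD[OF ideal_tet_ideal] ideal_multD[OF ideal_tet_ideal, of F])
      then show "?R \<subseteq> tet_ideal e"
        unfolding set_add_S PIdl_S by blast
    qed
    then show ?bdl
      using curve regular q_e' homogeneous_single[of q "1::'k"] homogeneous_single[of "Poly_Mapping.single v 1" "1::'k"]
      by (simp add: basic_double_link_def F Var_def)
  }
qed

section \<open>The four vertices of the tetrahedron\<close>

text \<open>The final default \<open>a6\<close> also covers sets that are not edges;
  \<open>tet_mons\<close> evaluates weights only at two-element sets.\<close>

definition edge_weights :: "nat \<Rightarrow> nat \<Rightarrow> nat \<Rightarrow> nat \<Rightarrow> nat \<Rightarrow> nat \<Rightarrow> coord set \<Rightarrow> nat" where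
  "edge_weights a1 a2 a3 a4 a5 a6 E =
    (if E = {A, B} then a1 else if E = {A, C} then a2 else if E = {A, D} then a3
     else if E = {B, C} then a4 else if E = {B, D} then a5 else a6)"

lemma edge_weights_simps [simp]:
  "edge_weights a1 a2 a3 a4 a5 a6 {A, B} = a1" "edge_weights a1 a2 a3 a4 a5 a6 {B, A} = a1"
  "edge_weights a1 a2 a3 a4 a5 a6 {A, C} = a2" "edge_weights a1 a2 a3 a4 a5 a6 {C, A} = a2"
  "edge_weights a1 a2 a3 a4 a5 a6 {A, D} = a3" "edge_weights a1 a2 a3 a4 a5 a6 {D, A} = a3"
  "edge_weights a1 a2 a3 a4 a5 a6 {B, C} = a4" "edge_weights a1 a2 a3 a4 a5 a6 {C, B} = a4"
  "edge_weights a1 a2 a3 a4 a5 a6 {B, D} = a5" "edge_weights a1 a2 a3 a4 a5 a6 {D, B} = a5"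
  "edge_weights a1 a2 a3 a4 a5 a6 {C, D} = a6" "edge_weights a1 a2 a3 a4 a5 a6 {D, C} = a6"
  by (simp_all add: edge_weights_def doubleton_eq_iff)

lemma all_coord: "(\<forall>x. P x) \<longleftrightarrow> P A \<and> P B \<and> P C \<and> P D"
  by (metis coord.exhaust)

lemma ex_coord: "(\<exists>x. P x) \<longleftrightarrow> P A \<or> P B \<or> P C \<or> P D"
  by (metis coord.exhaust)

lemma tetrahedral_ideal_eq:
  "tetrahedral_ideal a1 a2 a3 a4 a5 a6 = (tet_ideal (edge_weights a1 a2 a3 a4 a5 a6) :: 'k::field pol set)"
proof -
  have line: "line_ideal x y = (var_power {x, y} 1 :: 'k pol set)" for x y
    using genideal_vars[of "{x, y}"] by (simp add: line_ideal_def)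
  have "f \<in> tetrahedral_ideal a1 a2 a3 a4 a5 a6 \<longleftrightarrow> f \<in> tet_ideal (edge_weights a1 a2 a3 a4 a5 a6)" for f :: "'k pol"
    unfolding tetrahedral_ideal_def line ideal_power_vars tet_ideal_iff all_coord
    by (simp add: insert_commute) blast
  then show ?thesis by blast
qed

theorem proposition3p1:
  fixes a1 a2 a3 a4 a5 a6 :: nat
    and a1' a2' a3' a4' a5' a6' :: nat
    and I :: "'k::field pol set"
  assumes not_all_zero: "\<not> (a1 = 0 \<and> a2 = 0 \<and> a3 = 0 \<and> a4 = 0 \<and> a5 = 0 \<and> a6 = 0)"
    and I: "I = tetrahedral_ideal a1 a2 a3 a4 a5 a6"
    and a1': "int a1' = max 0 (int a1 - 1)"
    and a2': "int a2' = max 0 (int a2 - 1)"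
    and a3': "int a3' = max 0 (int a3 - 1)"
    and a4': "int a4' = max 0 (int a4 - 1)"
    and a5': "int a5' = max 0 (int a5 - 1)"
    and a6': "int a6' = max 0 (int a6 - 1)"
  shows
    "((a1 + a2 \<ge> a4 \<and> a1 + a3 \<ge> a5 \<and> a2 + a3 \<ge> a6) \<longleftrightarrow>
        basic_double_link I (tetrahedral_ideal a1' a2' a3' a4 a5 a6)
          (Var B ^ a1 * Var C ^ a2 * Var D ^ a3) (Var A)) \<and>
     ((a1 + a4 \<ge> a2 \<and> a1 + a5 \<ge> a3 \<and> a4 + a5 \<ge> a6) \<longleftrightarrow>
        basic_double_link I (tetrahedral_ideal a1' a2 a3 a4' a5' a6)
          (Var A ^ a1 * Var C ^ a4 * Var D ^ a5) (Var B)) \<and>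
     ((a2 + a4 \<ge> a1 \<and> a2 + a6 \<ge> a3 \<and> a4 + a6 \<ge> a5) \<longleftrightarrow>
        basic_double_link I (tetrahedral_ideal a1 a2' a3 a4' a5 a6')
          (Var A ^ a2 * Var B ^ a4 * Var D ^ a6) (Var C)) \<and>
     ((a3 + a5 \<ge> a1 \<and> a3 + a6 \<ge> a2 \<and> a5 + a6 \<ge> a4) \<longleftrightarrow>
        basic_double_link I (tetrahedral_ideal a1 a2 a3' a4 a5' a6')
          (Var A ^ a3 * Var B ^ a5 * Var C ^ a6) (Var D))"
proof -
  let ?e = "edge_weights a1 a2 a3 a4 a5 a6"
  have dec: "a1' = a1 - 1" "a2' = a2 - 1" "a3' = a3 - 1" "a4' = a4 - 1" "a5' = a5 - 1" "a6' = a6 - 1"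
    using a1' a2' a3' a4' a5' a6' by auto
  have pos: "\<exists>x y. x \<noteq> y \<and> 0 < ?e {x, y}"
    using not_all_zero by (simp add: ex_coord) blast
  have compl: "- {A} = {B, C, D}" "- {B} = {A, C, D}" "- {C} = {A, B, D}" "- {D} = {A, B, C}"
    using UNIV_coord by auto
  have "(a1 + a2 \<ge> a4 \<and> a1 + a3 \<ge> a5 \<and> a2 + a3 \<ge> a6) \<longleftrightarrow>
        basic_double_link I (tetrahedral_ideal a1' a2' a3' a4 a5 a6)
          (Var B ^ a1 * Var C ^ a2 * Var D ^ a3) (Var A)"
    \<comment> \<open>The vertex statement lists each edge of the opposite face in both orders;
      commutativity of addition merges the duplicate inequalities.\<close>
    using basic_double_link_at_vertex[where ?'k = 'k, OF pos, of A "edge_weights a1' a2' a3' a4 a5 a6"]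
    by (simp add: all_coord dec compl I tetrahedral_ideal_eq mult.assoc) (auto simp: add.commute)
  moreover have "(a1 + a4 \<ge> a2 \<and> a1 + a5 \<ge> a3 \<and> a4 + a5 \<ge> a6) \<longleftrightarrow>
        basic_double_link I (tetrahedral_ideal a1' a2 a3 a4' a5' a6)
          (Var A ^ a1 * Var C ^ a4 * Var D ^ a5) (Var B)"
    using basic_double_link_at_vertex[where ?'k = 'k, OF pos, of B "edge_weights a1' a2 a3 a4' a5' a6"]
    by (simp add: all_coord dec compl I tetrahedral_ideal_eq mult.assoc) (auto simp: add.commute)
  moreover have "(a2 + a4 \<ge> a1 \<and> a2 + a6 \<ge> a3 \<and> a4 + a6 \<ge> a5) \<longleftrightarrow>
        basic_double_link I (tetrahedral_ideal a1 a2' a3 a4' a5 a6')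
          (Var A ^ a2 * Var B ^ a4 * Var D ^ a6) (Var C)"
    using basic_double_link_at_vertex[where ?'k = 'k, OF pos, of C "edge_weights a1 a2' a3 a4' a5 a6'"]
    by (simp add: all_coord dec compl I tetrahedral_ideal_eq mult.assoc) (auto simp: add.commute)
  moreover have "(a3 + a5 \<ge> a1 \<and> a3 + a6 \<ge> a2 \<and> a5 + a6 \<ge> a4) \<longleftrightarrow>
        basic_double_link I (tetrahedral_ideal a1 a2 a3' a4 a5' a6')
          (Var A ^ a3 * Var B ^ a5 * Var C ^ a6) (Var D)"
    using basic_double_link_at_vertex[where ?'k = 'k, OF pos, of D "edge_weights a1 a2 a3' a4 a5' a6'"]
    by (simp add: all_coord dec compl I tetrahedral_ideal_eq mult.assoc) (auto simp: add.commute)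
  ultimately show ?thesis
    by blast
qed

end
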